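(* Let $(X,d)$ be a metric space, let $\{f_n\}_{n\in\mathbb{N}^+}$ be a sequence of uniformly continuous maps $f_n:X\to X$ which is pointwise weak orbitally convergent to a uniformly continuous map $f:X\to X$, let $\mu$ be a non-atomic Borel measure on $X$, and let $x\in X$. Then the following statements are true: (i) $x\in E^{+}(f,\mu)$ if and only if there exists $\delta>0$ such that $\mu(\{y\in X:\bigcup_{m\geq 1}\bigcap_{n\geq m}E^{+}_{x}(f_n,y,\delta)=\emptyset\})=0$. (ii) $x\in EM^{+}(f)$ if and only if there exists $\delta>0$ such that $\nu(\{y\in X:\bigcup_{m\geq 1}\bigcap_{n\geq m}E^{+}_{x}(f_n,y,\delta)=\emptyset\})=0$ for every non-atomic Borel measure $\nu$ on $X$. (iii) $x\in ES^{+}(f)$ if and only if there exists $\delta>0$ such that $\nu(\{y\in X:\bigcup_{m\geq 1}\bigcap_{n\geq m}E^{+}_{x}(f_n,y,\delta)=\emptyset\})=\nu(\{x\})$ for every Borel measure $\nu$ on $X$. (iv) If $f$ and all $f_n$ are uniform equivalences and $\{f_n^{-1}\}_{n\in\mathbb{N}^+}$ is pointwise weak orbitally convergent to $f^{-1}$, then: (a) $x\in E(f,\mu)$ if and only if there exists $\delta>0$ such that $\mu(\{y\in X:\bigcup_{m\geq 1}\bigcap_{n\geq m}E_{x}(f_n,y,\delta)=\emptyset\})=0$. (b) $x\in EM(f)$ if and only if there exists $\delta>0$ such that $\nu(\{y\in X:\bigcup_{m\geq 1}\bigcap_{n\geq m}E_{x}(f_n,y,\delta)=\emptyset\})=0$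 for every non-atomic Borel measure $\nu$ on $X$. (c) $x\in ES(f)$ if and only if there exists $\delta>0$ such that $\nu(\{y\in X:\bigcup_{m\geq 1}\bigcap_{n\geq m}E_{x}(f_n,y,\delta)=\emptyset\})=\nu(\{x\})$ for every Borel measure $\nu$ on $X$.
   Context: $\mathbb{N}=\{0,1,2,\dots\}$, $\mathbb{N}^+=\{1,2,\dots\}$; $f^k$ denotes the $k$-th iterate. A uniform equivalence of $X$ is a bijection $f:X\to X$ such that both $f$ and $f^{-1}$ are uniformly continuous. Every Borel measure $\mu$ on $X$ is assumed non-trivial, i.e. $\mu(X)>0$. A measure $\mu$ is non-atomic if $\mu(\{x\})=0$ for every $x\in X$. A sequence of uniformly continuous maps $g_n:X\to X$ is pointwise weak orbitally convergent to a uniformly continuous $g:X\to X$ if for every $x\in X$, $k\in\mathbb{N}^+$ and $\epsilon>0$ there is $N\in\mathbb{N}^+$ (depending on $x,\epsilon,k$) such that $d(g_n^k(x),g^k(x))<\epsilon$ for all $n\geq N$. For uniformly continuous $g:X\to X$ set $E^{+}_{x}(g,y,\epsilon)=\{n\in\mathbb{N}: d(g^n(x),g^n(y))>\epsilon\}$ and $\Phi^{g}_{\delta}(x)=\{y\in X: d(g^n(x),g^n(y))\leq\delta\text{ for each }n\in\mathbb{N}\}$. For a uniform equivalence $g$ set $E_{x}(g,y,\epsilon)=\{n\in\mathbb{Z}: d(g^n(x),g^n(y))>\epsilon\}$ and $\Gamma^{g}_{\delta}(x)=\{y\in X: d(g^n(x),g^n(y))\leq\delta\text{ for each }n\in\mathbb{Z}\}$.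 - $E^{+}(g,\mu)$ (resp. $E(g,\mu)$): the set of $x\in X$ for which there is $\delta_x>0$ with $\mu(\Phi^{g}_{\delta_x}(x))=0$ (resp. $\mu(\Gamma^{g}_{\delta_x}(x))=0$). - $EM^{+}(g)$ (resp. $EM(g)$): the set of $x\in X$ for which there is $\delta_x>0$ such that $\nu(\Phi^{g}_{\delta_x}(x))=0$ (resp. $\nu(\Gamma^{g}_{\delta_x}(x))=0$) for every non-atomic Borel measure $\nu$ on $X$. - $ES^{+}(g)$ (resp. $ES(g)$): the set of $x\in X$ for which there is $\delta_x>0$ such that $\nu(\Phi^{g}_{\delta_x}(x))=\nu(\{x\})$ (resp. $\nu(\Gamma^{g}_{\delta_x}(x))=\nu(\{x\})$) for every Borel measure $\nu$ on $X$. *)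

theory Defs
  imports "HOL-Analysis.Analysis"
begin

definition uniform_equivalence :: "('a::metric_space \<Rightarrow> 'a) \<Rightarrow> bool" where
  "uniform_equivalence g \<longleftrightarrow>
     bij g \<and> uniformly_continuous_on UNIV g \<and> uniformly_continuous_on UNIV (inv g)"

text \<open>Integer iterates; only meaningful when \<open>g\<close> is bijective.\<close>
definition int_iterate :: "('a \<Rightarrow> 'a) \<Rightarrow> int \<Rightarrow> 'a \<Rightarrow> 'a" where
  "int_iterate g k = (if 0 \<le> k then g ^^ nat k else inv g ^^ nat (- k))"

text \<open>Sequences are indexed by the positive integers: the value at index \<open>0\<close> is irrelevant.\<close>
definition pw_weak_orbitally_convergent ::
    "(nat \<Rightarrow> 'a::metric_space \<Rightarrow> 'a) \<Rightarrow> ('a \<Rightarrow> 'a) \<Rightarrow> bool" where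
  "pw_weak_orbitally_convergent gs g \<longleftrightarrow>
     (\<forall>x. \<forall>k\<ge>1. \<forall>\<epsilon>>0. \<exists>N\<ge>1. \<forall>n\<ge>N. dist ((gs n ^^ k) x) ((g ^^ k) x) < \<epsilon>)"

text \<open>Borel measures take values in \<open>[0,\<infinity>]\<close>, are not assumed finite or \<open>\<sigma>\<close>-finite,
  and are non-trivial by convention.\<close>
definition borel_measure :: "'a::metric_space measure \<Rightarrow> bool" where
  "borel_measure \<mu> \<longleftrightarrow> sets \<mu> = sets borel \<and> emeasure \<mu> UNIV > 0"

definition nonatomic :: "'a measure \<Rightarrow> bool" where
  "nonatomic \<mu> \<longleftrightarrow> (\<forall>x. emeasure \<mu> {x} = 0)"

definition sep_times_pos ::
    "'a::metric_space \<Rightarrow> ('a \<Rightarrow> 'a) \<Rightarrow> 'a \<Rightarrow> real \<Rightarrow> nat set" where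
  "sep_times_pos x g y \<epsilon> = {n. dist ((g ^^ n) x) ((g ^^ n) y) > \<epsilon>}"

definition sep_times ::
    "'a::metric_space \<Rightarrow> ('a \<Rightarrow> 'a) \<Rightarrow> 'a \<Rightarrow> real \<Rightarrow> int set" where
  "sep_times x g y \<epsilon> = {n. dist (int_iterate g n x) (int_iterate g n y) > \<epsilon>}"

text \<open>For uniformly continuous \<open>g\<close> (resp. a uniform equivalence \<open>g\<close>) the following sets are
  closed, hence measurable for every Borel measure.\<close>
definition Phi_set :: "('a::metric_space \<Rightarrow> 'a) \<Rightarrow> real \<Rightarrow> 'a \<Rightarrow> 'a set" where
  "Phi_set g \<delta> x = {y. \<forall>n. dist ((g ^^ n) x) ((g ^^ n) y) \<le> \<delta>}"

definition Gamma_set :: "('a::metric_space \<Rightarrow> 'a) \<Rightarrow> real \<Rightarrow> 'a \<Rightarrow> 'a set" where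
  "Gamma_set g \<delta> x = {y. \<forall>n. dist (int_iterate g n x) (int_iterate g n y) \<le> \<delta>}"

definition E_pos :: "('a::metric_space \<Rightarrow> 'a) \<Rightarrow> 'a measure \<Rightarrow> 'a set" where
  "E_pos g \<mu> = {x. \<exists>\<delta>>0. emeasure \<mu> (Phi_set g \<delta> x) = 0}"

definition E_full :: "('a::metric_space \<Rightarrow> 'a) \<Rightarrow> 'a measure \<Rightarrow> 'a set" where
  "E_full g \<mu> = {x. \<exists>\<delta>>0. emeasure \<mu> (Gamma_set g \<delta> x) = 0}"

definition EM_pos :: "('a::metric_space \<Rightarrow> 'a) \<Rightarrow> 'a set" where
  "EM_pos g = {x. \<exists>\<delta>>0. \<forall>\<nu>. borel_measure \<nu> \<and> nonatomic \<nu> \<longrightarrow>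
     emeasure \<nu> (Phi_set g \<delta> x) = 0}"

definition EM_full :: "('a::metric_space \<Rightarrow> 'a) \<Rightarrow> 'a set" where
  "EM_full g = {x. \<exists>\<delta>>0. \<forall>\<nu>. borel_measure \<nu> \<and> nonatomic \<nu> \<longrightarrow>
     emeasure \<nu> (Gamma_set g \<delta> x) = 0}"

definition ES_pos :: "('a::metric_space \<Rightarrow> 'a) \<Rightarrow> 'a set" where
  "ES_pos g = {x. \<exists>\<delta>>0. \<forall>\<nu>. borel_measure \<nu> \<longrightarrow>
     emeasure \<nu> (Phi_set g \<delta> x) = emeasure \<nu> {x}}"

definition ES_full :: "('a::metric_space \<Rightarrow> 'a) \<Rightarrow> 'a set" where
  "ES_full g = {x. \<exists>\<delta>>0. \<forall>\<nu>. borel_measure \<nu> \<longrightarrow>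
     emeasure \<nu> (Gamma_set g \<delta> x) = emeasure \<nu> {x}}"

end

theory Submission
  imports Defs
begin

text \<open>The set of points never eventually \<open>\<delta>\<close>-separated from \<open>x\<close> along the approximating maps lies
  between the \<open>\<delta>/2\<close>-ball and the \<open>\<delta>\<close>-ball of the limit dynamics around \<open>x\<close>, because distances
  between orbit points converge. All sets involved are Borel, so a set \<open>S\<close> contained in every ball
  has the same measure as some ball if and only if it has the same measure as some set of the other
  kind; take \<open>S = {}\<close> or \<open>S = {x}\<close>.\<close>

text \<open>The argument \<open>g\<close> is the whole family of iterates, indexed by time, rather
  than a single map. With time \<open>nat\<close> this gives \<open>Phi_set\<close>, with time
  \<open>int\<close> it gives \<open>Gamma_set\<close>, so one argument covers both halves of the
  theorem.\<close>

definition dyn_ball :: "('i \<Rightarrow> 'a \<Rightarrow> 'a::metric_space) \<Rightarrow> real \<Rightarrow> 'a \<Rightarrow> 'a set" where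
  "dyn_ball g \<delta> x = {y. \<forall>i. dist (g i x) (g i y) \<le> \<delta>}"

definition unseparated ::
    "(nat \<Rightarrow> 'i \<Rightarrow> 'a \<Rightarrow> 'a::metric_space) \<Rightarrow> real \<Rightarrow> 'a \<Rightarrow> 'a set" where
  "unseparated G \<delta> x =
     {y. (\<Union>m\<in>{1..}. \<Inter>n\<in>{m..}. {i. dist (G n i x) (G n i y) > \<delta>}) = {}}"

text \<open>Negating the quantifiers says that at each time \<open>i\<close> the bound \<le>
  \<delta> holds for arbitrarily large \<open>n\<close>. For countably many times this builds the
  set from closed sets by countable operations.\<close>

lemma unseparated_altdef:
  "unseparated G \<delta> x = (\<Inter>i. \<Inter>m\<in>{1..}. \<Union>n\<in>{m..}. {y. dist (G n i x) (G n i y) \<le> \<delta>})"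
  unfolding unseparated_def by (auto simp: set_eq_iff not_less)

lemma closed_dist_le:
  fixes h :: "'a::metric_space \<Rightarrow> 'b::metric_space"
  assumes "continuous_on UNIV h"
  shows "closed {y. dist c (h y) \<le> \<delta>}"
  by (intro closed_Collect_le continuous_intros assms)

lemma borel_dyn_ball:
  assumes "\<And>i. continuous_on UNIV (g i)"
  shows "dyn_ball g \<delta> x \<in> sets borel"
proof -
  have "dyn_ball g \<delta> x = (\<Inter>i. {y. dist (g i x) (g i y) \<le> \<delta>})"
    by (auto simp: dyn_ball_def)
  then show ?thesis
    by (auto intro!: borel_closed closed_INT closed_dist_le assms)
qed

lemma borel_unseparated:
  fixes G :: "nat \<Rightarrow> 'i::countable \<Rightarrow> 'a \<Rightarrow> 'a::metric_space"
  assumes "\<And>n i. n \<ge> 1 \<Longrightarrow> continuous_on UNIV (G n i)"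
  shows "unseparated G \<delta> x \<in> sets borel"
  unfolding unseparated_altdef
  by (intro sets.countable_INT'' sets.countable_INT' sets.countable_UN')
    (auto intro!: borel_closed closed_dist_le assms)

text \<open>If the limit distance at some time exceeded \<delta>, then by convergence so would the
  distances for all large \<open>n\<close>, which separates \<open>y\<close> from \<open>x\<close>
  at that time.\<close>

lemma unseparated_subset_dyn_ball:
  assumes "\<And>i y. (\<lambda>n. G n i y) \<longlonglongrightarrow> g i y"
  shows "unseparated G \<delta> x \<subseteq> dyn_ball g \<delta> x"
proof
  fix y assume y: "y \<in> unseparated G \<delta> x"
  have "dist (g i x) (g i y) \<le> \<delta>" for i
  proof (rule ccontr)
    assume "\<not> ?thesis"
    moreover have "(\<lambda>n. dist (G n i x) (G n i y)) \<longlonglongrightarrow> dist (g i x) (g i y)"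
      by (intro tendsto_dist assms)
    ultimately have "\<forall>\<^sub>F n in sequentially. dist (G n i x) (G n i y) > \<delta>"
      by (simp add: order_tendstoD(1))
    then obtain N where N: "\<And>n. n \<ge> N \<Longrightarrow> dist (G n i x) (G n i y) > \<delta>"
      by (auto simp: eventually_sequentially)
    \<comment> \<open>The index \<open>m\<close> ranges over \<open>{1..}\<close> while
      \<open>N\<close> may be 0, hence \<open>Suc N\<close>.\<close>
    obtain n where "n \<ge> Suc N" "dist (G n i x) (G n i y) \<le> \<delta>"
      using y unfolding unseparated_altdef by force
    with N[of n] show False by simp
  qed
  then show "y \<in> dyn_ball g \<delta> x" by (simp add: dyn_ball_def)
qed

text \<open>The strict gap between the radii is essential to the argument: a limit distance equal to
  \<delta> could be approached from above, whereas one below \<delta> forces the approximating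
  distances below \<delta> eventually.\<close>

lemma dyn_ball_subset_unseparated:
  assumes "\<And>i y. (\<lambda>n. G n i y) \<longlonglongrightarrow> g i y" and "\<delta>' < \<delta>"
  shows "dyn_ball g \<delta>' x \<subseteq> unseparated G \<delta> x"
proof
  fix y assume y: "y \<in> dyn_ball g \<delta>' x"
  have "\<exists>n\<ge>m. dist (G n i x) (G n i y) \<le> \<delta>" for i m
  proof -
    have "(\<lambda>n. dist (G n i x) (G n i y)) \<longlonglongrightarrow> dist (g i x) (g i y)"
      by (intro tendsto_dist assms)
    moreover have "dist (g i x) (g i y) < \<delta>"
      using y assms(2) by (auto simp: dyn_ball_def intro: le_less_trans)
    ultimately have "\<forall>\<^sub>F n in sequentially. dist (G n i x) (G n i y) < \<delta>"
      by (rule order_tendstoD(2))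
    then obtain N where "\<And>n. n \<ge> N \<Longrightarrow> dist (G n i x) (G n i y) < \<delta>"
      by (auto simp: eventually_sequentially)
    then show ?thesis by (intro exI[of _ "max m N"]) (simp add: less_imp_le)
  qed
  then show "y \<in> unseparated G \<delta> x" by (auto simp: unseparated_altdef)
qed

text \<open>The predicate \<open>Q\<close> selects the measures over which \<delta> has to be
  uniform: a single one, the non-atomic ones, or all Borel measures. All six equivalences of the
  theorem are instances.\<close>

lemma emeasure_dyn_ball_iff_unseparated:
  fixes G :: "nat \<Rightarrow> 'i::countable \<Rightarrow> 'a \<Rightarrow> 'a::metric_space"
  assumes conv: "\<And>i y. (\<lambda>n. G n i y) \<longlonglongrightarrow> g i y"
    and contG: "\<And>n i. n \<ge> 1 \<Longrightarrow> continuous_on UNIV (G n i)"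
    and contg: "\<And>i. continuous_on UNIV (g i)"
    and sets: "\<And>\<nu>. Q \<nu> \<Longrightarrow> sets \<nu> = sets borel"
    and S: "S \<subseteq> {x}"
  shows "(\<exists>\<delta>>0. \<forall>\<nu>. Q \<nu> \<longrightarrow> emeasure \<nu> (dyn_ball g \<delta> x) = emeasure \<nu> S) \<longleftrightarrow>
    (\<exists>\<delta>>0. \<forall>\<nu>. Q \<nu> \<longrightarrow> emeasure \<nu> (unseparated G \<delta> x) = emeasure \<nu> S)"
    (is "?L \<longleftrightarrow> ?R")
proof -
  \<comment> \<open>Only monotonicity is used, with no subtraction of measures, so infinite values
    are harmless.\<close>
  have squeeze: "emeasure \<nu> A = emeasure \<nu> S"
    if "Q \<nu>" "S \<subseteq> A" "A \<subseteq> B" "A \<in> sets borel" "B \<in> sets borel"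
      "emeasure \<nu> B = emeasure \<nu> S" for \<nu> A B
    using that sets[OF that(1)] emeasure_mono[of S A \<nu>] emeasure_mono[of A B \<nu>]
    by (intro antisym) auto
  note [simp] = borel_dyn_ball[of g, OF contg] borel_unseparated[of G, OF contG]
  have S_ball: "S \<subseteq> dyn_ball g \<delta> x" if "\<delta> > 0" for \<delta>
    using S that by (auto simp: dyn_ball_def)
  have half: "dyn_ball g (\<delta> / 2) x \<subseteq> unseparated G \<delta> x" if "\<delta> > 0" for \<delta>
    using that by (intro dyn_ball_subset_unseparated conv) simp
  show ?thesis
  proof
    assume ?L
    then obtain \<delta> where "\<delta> > 0"
      and "\<forall>\<nu>. Q \<nu> \<longrightarrow> emeasure \<nu> (dyn_ball g \<delta> x) = emeasure \<nu> S" by blast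
    \<comment> \<open>The same \<delta> serves as witness here; the half-radius ball is used only to
      place \<open>S\<close> inside the smaller set.\<close>
    moreover have "S \<subseteq> unseparated G \<delta> x"
      using S_ball[of "\<delta> / 2"] half[of \<delta>] \<open>\<delta> > 0\<close> by auto
    ultimately show ?R
      using squeeze[OF _ _ unseparated_subset_dyn_ball[of G g, OF conv]]
      by (intro exI[of _ \<delta>]) simp
  next
    assume ?R
    then obtain \<delta> where "\<delta> > 0"
      and "\<forall>\<nu>. Q \<nu> \<longrightarrow> emeasure \<nu> (unseparated G \<delta> x) = emeasure \<nu> S" by blast
    \<comment> \<open>The radius must be halved in this direction, since the ball now has to lie
      inside the null or one-point-like set.\<close>
    then show ?L
      using squeeze S_ball[of "\<delta> / 2"] half[of \<delta>]
      by (intro exI[of _ "\<delta> / 2"]) simp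
  qed
qed

lemma pw_weak_orbitally_convergent_tendsto:
  assumes "pw_weak_orbitally_convergent gs g"
  shows "(\<lambda>n. (gs n ^^ k) y) \<longlonglongrightarrow> (g ^^ k) y"
\<comment> \<open>Orbital convergence speaks of k \<ge> 1 only; at time 0 both iterates are the
  identity and the sequence is constant.\<close>
proof (cases "k = 0")
  case False
  then show ?thesis
    using assms unfolding pw_weak_orbitally_convergent_def LIMSEQ_def
    by (metis One_nat_def Suc_leI neq0_conv)
qed simp

text \<open>Negative times are iterates of the inverses, which is where the convergence of the
  inverse maps enters.\<close>

lemma int_iterate_tendsto:
  assumes "pw_weak_orbitally_convergent gs g"
    and "pw_weak_orbitally_convergent (\<lambda>n. inv (gs n)) (inv g)"
  shows "(\<lambda>n. int_iterate (gs n) k y) \<longlonglongrightarrow> int_iterate g k y"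
  using assms by (simp add: int_iterate_def pw_weak_orbitally_convergent_tendsto)

lemma continuous_on_funpow:
  fixes g :: "'a::topological_space \<Rightarrow> 'a"
  assumes "continuous_on UNIV g"
  shows "continuous_on UNIV (g ^^ k)"
proof (induction k)
  case (Suc k)
  then show ?case
    using assms continuous_on_compose[of UNIV "g ^^ k" g] by (auto intro: continuous_on_subset)
qed (simp add: id_def)

lemma continuous_on_int_iterate:
  assumes "uniform_equivalence g"
  shows "continuous_on UNIV (int_iterate g k)"
  using assms
  unfolding uniform_equivalence_def int_iterate_def
  by (simp add: continuous_on_funpow uniformly_continuous_imp_continuous)

theorem theorem3p5:
  fixes fs :: "nat \<Rightarrow> 'a::metric_space \<Rightarrow> 'a" and f :: "'a \<Rightarrow> 'a"
    and \<mu> :: "'a measure" and x :: 'a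
  assumes "\<And>n. n \<ge> 1 \<Longrightarrow> uniformly_continuous_on UNIV (fs n)"
    and "uniformly_continuous_on UNIV f"
    and "pw_weak_orbitally_convergent fs f"
    and "borel_measure \<mu>" and "nonatomic \<mu>"
  shows
    "(x \<in> E_pos f \<mu> \<longleftrightarrow> (\<exists>\<delta>>0.
        emeasure \<mu> {y. (\<Union>m\<in>{1..}. \<Inter>n\<in>{m..}. sep_times_pos x (fs n) y \<delta>) = {}} = 0)) \<and>
     (x \<in> EM_pos f \<longleftrightarrow> (\<exists>\<delta>>0. \<forall>\<nu>. borel_measure \<nu> \<and> nonatomic \<nu> \<longrightarrow>
        emeasure \<nu> {y. (\<Union>m\<in>{1..}. \<Inter>n\<in>{m..}. sep_times_pos x (fs n) y \<delta>) = {}} = 0)) \<and>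
     (x \<in> ES_pos f \<longleftrightarrow> (\<exists>\<delta>>0. \<forall>\<nu>. borel_measure \<nu> \<longrightarrow>
        emeasure \<nu> {y. (\<Union>m\<in>{1..}. \<Inter>n\<in>{m..}. sep_times_pos x (fs n) y \<delta>) = {}} = emeasure \<nu> {x})) \<and>
     (uniform_equivalence f \<and> (\<forall>n\<ge>1. uniform_equivalence (fs n)) \<and>
      pw_weak_orbitally_convergent (\<lambda>n. inv (fs n)) (inv f) \<longrightarrow>
        (x \<in> E_full f \<mu> \<longleftrightarrow> (\<exists>\<delta>>0.
           emeasure \<mu> {y. (\<Union>m\<in>{1..}. \<Inter>n\<in>{m..}. sep_times x (fs n) y \<delta>) = {}} = 0)) \<and>
        (x \<in> EM_full f \<longleftrightarrow> (\<exists>\<delta>>0. \<forall>\<nu>. borel_measure \<nu> \<and> nonatomic \<nu> \<longrightarrow>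
           emeasure \<nu> {y. (\<Union>m\<in>{1..}. \<Inter>n\<in>{m..}. sep_times x (fs n) y \<delta>) = {}} = 0)) \<and>
        (x \<in> ES_full f \<longleftrightarrow> (\<exists>\<delta>>0. \<forall>\<nu>. borel_measure \<nu> \<longrightarrow>
           emeasure \<nu> {y. (\<Union>m\<in>{1..}. \<Inter>n\<in>{m..}. sep_times x (fs n) y \<delta>) = {}} = emeasure \<nu> {x})))"
proof -
  have sets_\<mu>: "sets \<mu> = sets borel"
    and sets_borel_measure: "\<And>\<nu>. borel_measure \<nu> \<Longrightarrow> sets \<nu> = sets borel"
    using assms(4) by (auto simp: borel_measure_def)
  then have sets_nonatomic: "\<And>\<nu>. borel_measure \<nu> \<and> nonatomic \<nu> \<Longrightarrow> sets \<nu> = sets borel"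
    by blast
  have Phi: "Phi_set f \<delta> x = dyn_ball (\<lambda>k. f ^^ k) \<delta> x" for \<delta>
    by (simp add: Phi_set_def dyn_ball_def)
  have Gamma: "Gamma_set f \<delta> x = dyn_ball (int_iterate f) \<delta> x" for \<delta>
    by (simp add: Gamma_set_def dyn_ball_def)
  have pos: "{y. (\<Union>m\<in>{1..}. \<Inter>n\<in>{m..}. sep_times_pos x (fs n) y \<delta>) = {}} =
      unseparated (\<lambda>n k. fs n ^^ k) \<delta> x" for \<delta>
    by (simp add: unseparated_def sep_times_pos_def)
  have full: "{y. (\<Union>m\<in>{1..}. \<Inter>n\<in>{m..}. sep_times x (fs n) y \<delta>) = {}} =
      unseparated (\<lambda>n. int_iterate (fs n)) \<delta> x" for \<delta>
    by (simp add: unseparated_def sep_times_def)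
  have conv: "(\<lambda>n. (fs n ^^ k) y) \<longlonglongrightarrow> (f ^^ k) y" for k y
    by (rule pw_weak_orbitally_convergent_tendsto[OF assms(3)])
  have contG: "continuous_on UNIV (fs n ^^ k)" if "n \<ge> 1" for n k
    using assms(1)[OF that] by (intro continuous_on_funpow uniformly_continuous_imp_continuous)
  have contg: "continuous_on UNIV (f ^^ k)" for k
    using assms(2) by (intro continuous_on_funpow uniformly_continuous_imp_continuous)
  \<comment> \<open>\<open>Q\<close> and \<open>S\<close> stay open here, to be chosen separately
    for each of the three statements.\<close>
  note pos_iff = emeasure_dyn_ball_iff_unseparated
    [where G = "\<lambda>n k. fs n ^^ k" and g = "\<lambda>k. f ^^ k" and x = x, OF conv contG contg]
  note full_iff = emeasure_dyn_ball_iff_unseparated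
    [where G = "\<lambda>n. int_iterate (fs n)" and g = "int_iterate f" and x = x,
      OF int_iterate_tendsto continuous_on_int_iterate continuous_on_int_iterate]
  have E: "x \<in> E_pos f \<mu> \<longleftrightarrow>
      (\<exists>\<delta>>0. emeasure \<mu> (unseparated (\<lambda>n k. fs n ^^ k) \<delta> x) = 0)"
    \<comment> \<open>Equality with \<mu> as \<open>Q\<close> collapses the quantifier over measures
      to \<mu> alone, and the empty set as \<open>S\<close> turns the common value into 0.\<close>
    using pos_iff[where Q = "\<lambda>\<nu>. \<nu> = \<mu>" and S = "{}"] sets_\<mu>
    by (simp add: E_pos_def Phi)
  have EM: "x \<in> EM_pos f \<longleftrightarrow> (\<exists>\<delta>>0. \<forall>\<nu>. borel_measure \<nu> \<and> nonatomic \<nu> \<longrightarrow>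
      emeasure \<nu> (unseparated (\<lambda>n k. fs n ^^ k) \<delta> x) = 0)"
    using pos_iff[where Q = "\<lambda>\<nu>. borel_measure \<nu> \<and> nonatomic \<nu>" and S = "{}", OF _ sets_nonatomic]
    by (simp add: EM_pos_def Phi)
  have ES: "x \<in> ES_pos f \<longleftrightarrow> (\<exists>\<delta>>0. \<forall>\<nu>. borel_measure \<nu> \<longrightarrow>
      emeasure \<nu> (unseparated (\<lambda>n k. fs n ^^ k) \<delta> x) = emeasure \<nu> {x})"
    using pos_iff[where Q = borel_measure and S = "{x}", OF _ sets_borel_measure]
    by (simp add: ES_pos_def Phi)
  have "(x \<in> E_full f \<mu> \<longleftrightarrow>
        (\<exists>\<delta>>0. emeasure \<mu> (unseparated (\<lambda>n. int_iterate (fs n)) \<delta> x) = 0)) \<and>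
      (x \<in> EM_full f \<longleftrightarrow> (\<exists>\<delta>>0. \<forall>\<nu>. borel_measure \<nu> \<and> nonatomic \<nu> \<longrightarrow>
        emeasure \<nu> (unseparated (\<lambda>n. int_iterate (fs n)) \<delta> x) = 0)) \<and>
      (x \<in> ES_full f \<longleftrightarrow> (\<exists>\<delta>>0. \<forall>\<nu>. borel_measure \<nu> \<longrightarrow>
        emeasure \<nu> (unseparated (\<lambda>n. int_iterate (fs n)) \<delta> x) = emeasure \<nu> {x}))"
    if equiv: "uniform_equivalence f" "\<forall>n\<ge>1. uniform_equivalence (fs n)"
      and inv_conv: "pw_weak_orbitally_convergent (\<lambda>n. inv (fs n)) (inv f)"
  proof (intro conjI)
    \<comment> \<open>The premises left open in \<open>full_iff\<close> are convergence of the maps,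
      convergence of their inverses, and uniform equivalence of each \<open>fs n\<close> with n
      \<ge> 1 and of \<open>f\<close>.\<close>
    note full_iff' = full_iff[OF assms(3) inv_conv equiv(2)[rule_format] equiv(1)]
    show "x \<in> E_full f \<mu> \<longleftrightarrow>
        (\<exists>\<delta>>0. emeasure \<mu> (unseparated (\<lambda>n. int_iterate (fs n)) \<delta> x) = 0)"
      using full_iff'[where Q = "\<lambda>\<nu>. \<nu> = \<mu>" and S = "{}"] sets_\<mu>
      by (simp add: E_full_def Gamma)
    show "x \<in> EM_full f \<longleftrightarrow> (\<exists>\<delta>>0. \<forall>\<nu>. borel_measure \<nu> \<and> nonatomic \<nu> \<longrightarrow>
        emeasure \<nu> (unseparated (\<lambda>n. int_iterate (fs n)) \<delta> x) = 0)"
      using full_iff'[where Q = "\<lambda>\<nu>. borel_measure \<nu> \<and> nonatomic \<nu>" and S = "{}",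
          OF _ sets_nonatomic]
      by (simp add: EM_full_def Gamma)
    show "x \<in> ES_full f \<longleftrightarrow> (\<exists>\<delta>>0. \<forall>\<nu>. borel_measure \<nu> \<longrightarrow>
        emeasure \<nu> (unseparated (\<lambda>n. int_iterate (fs n)) \<delta> x) = emeasure \<nu> {x})"
      using full_iff'[where Q = borel_measure and S = "{x}", OF _ sets_borel_measure]
      by (simp add: ES_full_def Gamma)
  qed
  with E EM ES show ?thesis
    unfolding pos full by blast
qed

end
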